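(* Given a connected $(P_3+2P_1)$-free graph $G$ with $n$ vertices and $m$ edges, one can decide whether $\operatorname{diam}(G)=5$ in $O(n+m)$ time. (Here $5=d_{\max}$, the maximum diameter of a connected $(P_3+2P_1)$-free graph.)
   Context: Graphs are finite, simple, undirected and unweighted. A graph is $H$-free if it does not contain $H$ as an induced subgraph; $P_3+2P_1$ is the disjoint union of a path on three vertices and two isolated vertices. $\operatorname{diam}(G)=\max_{u,v}d(u,v)$; $d_{\max}$ of a class is the supremum of the diameters of its graphs. *)

theory Defs
  imports Main "HOL-Library.Extended_Nat"
begin

section \<open>Finite simple graphs\<close>

record 'a graph =
  verts :: "'a set"
  edges :: "'a set set"

definition simple_graph :: "'a graph \<Rightarrow> bool" where
  "simple_graph G \<longleftrightarrow> finite (verts G) \<and> (\<forall>e\<in>edges G. e \<subseteq> verts G \<and> card e = 2)"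

definition induced_subgraph :: "'a graph \<Rightarrow> 'a set \<Rightarrow> 'a graph" where
  "induced_subgraph G S = \<lparr>verts = S, edges = {e \<in> edges G. e \<subseteq> S}\<rparr>"

definition graph_iso :: "'a graph \<Rightarrow> 'b graph \<Rightarrow> bool" where
  "graph_iso G H \<longleftrightarrow>
     (\<exists>f. bij_betw f (verts G) (verts H) \<and>
          (\<forall>u\<in>verts G. \<forall>v\<in>verts G. {u, v} \<in> edges G \<longleftrightarrow> {f u, f v} \<in> edges H))"

definition induced_free :: "'b graph \<Rightarrow> 'a graph \<Rightarrow> bool" where
  "induced_free H G \<longleftrightarrow> \<not> (\<exists>S\<subseteq>verts G. graph_iso (induced_subgraph G S) H)"

definition path_graph :: "nat \<Rightarrow> nat graph" where
  "path_graph k = \<lparr>verts = {..<k}, edges = {{i, Suc i} | i. Suc i < k}\<rparr>"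

definition disjoint_union :: "'a graph \<Rightarrow> 'b graph \<Rightarrow> ('a + 'b) graph" where
  "disjoint_union G H =
     \<lparr>verts = verts G <+> verts H, edges = (`) Inl ` edges G \<union> (`) Inr ` edges H\<rparr>"

definition P3_2P1 :: "(nat + nat + nat) graph" where
  "P3_2P1 = disjoint_union (path_graph 3) (disjoint_union (path_graph 1) (path_graph 1))"


section \<open>Distance, connectivity and diameter\<close>

definition walk :: "'a graph \<Rightarrow> 'a \<Rightarrow> 'a list \<Rightarrow> 'a \<Rightarrow> bool" where
  "walk G u p v \<longleftrightarrow>
     p \<noteq> [] \<and> hd p = u \<and> last p = v \<and> set p \<subseteq> verts G \<and>
     successively (\<lambda>x y. {x, y} \<in> edges G) p"

definition connected_graph :: "'a graph \<Rightarrow> bool" where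
  "connected_graph G \<longleftrightarrow> verts G \<noteq> {} \<and> (\<forall>u\<in>verts G. \<forall>v\<in>verts G. \<exists>p. walk G u p v)"

text \<open>Both \<open>graph_dist\<close> and \<open>diam\<close> are meaningful for finite connected graphs only.\<close>

definition graph_dist :: "'a graph \<Rightarrow> 'a \<Rightarrow> 'a \<Rightarrow> nat" where
  "graph_dist G u v = (LEAST k. \<exists>p. walk G u p v \<and> length p = Suc k)"

definition diam :: "'a graph \<Rightarrow> nat" where
  "diam G = Max {graph_dist G u v | u v. u \<in> verts G \<and> v \<in> verts G}"

text \<open>
  Every finite graph has an isomorphic copy with vertices in \<open>nat\<close>, so the supremum
  is taken over such graphs. It lives in \<open>enat\<close> because \<open>Sup\<close> on \<open>nat\<close> is unspecified
  for unbounded sets.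
\<close>

definition d_max :: "(nat graph \<Rightarrow> bool) \<Rightarrow> enat" where
  "d_max C = Sup {enat (diam G) | G. C G}"


text \<open>The class of all connected \<open>H\<close>-free graphs.\<close>

definition connected_free_graph :: "'b graph \<Rightarrow> 'a graph \<Rightarrow> bool" where
  "connected_free_graph H G \<longleftrightarrow> simple_graph G \<and> connected_graph G \<and> induced_free H G"


section \<open>Random access machine\<close>

text \<open>
  Unit-cost RAM with structured control flow. A program refers to a fixed finite number of
  registers and of arrays, all named by numbers. Array cells are addressed by register
  contents. The arithmetic is addition and truncated subtraction.
\<close>

datatype com =
    Skip
  | Const nat nat            \<comment> \<open>\<open>Const x v\<close>: \<open>x := v\<close>\<close>
  | Add nat nat nat          \<comment> \<open>\<open>Add x y z\<close>: \<open>x := y + z\<close>\<close>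
  | Sub nat nat nat          \<comment> \<open>\<open>Sub x y z\<close>: \<open>x := y - z\<close>\<close>
  | Load nat nat nat         \<comment> \<open>\<open>Load x b y\<close>: \<open>x := b[y]\<close>\<close>
  | Store nat nat nat        \<comment> \<open>\<open>Store b y x\<close>: \<open>b[y] := x\<close>\<close>
  | Seq com com
  | IfLess nat nat com com   \<comment> \<open>\<open>IfLess x y c d\<close>: if \<open>x < y\<close> then \<open>c\<close> else \<open>d\<close>\<close>
  | WhileLess nat nat com    \<comment> \<open>\<open>WhileLess x y c\<close>: while \<open>x < y\<close> do \<open>c\<close>\<close>

type_synonym state = "(nat \<Rightarrow> nat) \<times> (nat \<Rightarrow> nat \<Rightarrow> nat)"

text \<open>
  \<open>exec W c s t s'\<close>: started in \<open>s\<close>, the program \<open>c\<close> halts in \<open>s'\<close> after \<open>t\<close> steps, and no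
  computed value exceeds \<open>W\<close>. An overflow blocks the execution, so that a word holds
  about \<open>log W\<close> bits and unit costs cannot be abused by computing with huge numbers.
\<close>

inductive exec :: "nat \<Rightarrow> com \<Rightarrow> state \<Rightarrow> nat \<Rightarrow> state \<Rightarrow> bool" for W :: nat where
  Skip: "exec W Skip s 1 s"
| Const: "v \<le> W \<Longrightarrow> exec W (Const x v) (r, a) 1 (r(x := v), a)"
| Add: "r y + r z \<le> W \<Longrightarrow> exec W (Add x y z) (r, a) 1 (r(x := r y + r z), a)"
| Sub: "r y - r z \<le> W \<Longrightarrow> exec W (Sub x y z) (r, a) 1 (r(x := r y - r z), a)"
| Load: "exec W (Load x b y) (r, a) 1 (r(x := a b (r y)), a)"
| Store: "exec W (Store b y x) (r, a) 1 (r, a(b := (a b)(r y := r x)))"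
| Seq: "exec W c s t s' \<Longrightarrow> exec W d s' t' s'' \<Longrightarrow> exec W (Seq c d) s (t + t') s''"
| IfTrue: "r x < r y \<Longrightarrow> exec W c (r, a) t s' \<Longrightarrow> exec W (IfLess x y c d) (r, a) (1 + t) s'"
| IfFalse: "\<not> r x < r y \<Longrightarrow> exec W d (r, a) t s' \<Longrightarrow> exec W (IfLess x y c d) (r, a) (1 + t) s'"
| WhileFalse: "\<not> r x < r y \<Longrightarrow> exec W (WhileLess x y c) (r, a) 1 (r, a)"
| WhileTrue: "r x < r y \<Longrightarrow> exec W c (r, a) t s' \<Longrightarrow> exec W (WhileLess x y c) s' t' s'' \<Longrightarrow>
    exec W (WhileLess x y c) (r, a) (1 + t + t') s''"

inductive_cases exec_SkipE: "exec W Skip s t s'"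
inductive_cases exec_ConstE: "exec W (Const x v) s t s'"
inductive_cases exec_AddE: "exec W (Add x y z) s t s'"
inductive_cases exec_SubE: "exec W (Sub x y z) s t s'"
inductive_cases exec_LoadE: "exec W (Load x b y) s t s'"
inductive_cases exec_StoreE: "exec W (Store b y x) s t s'"
inductive_cases exec_SeqE: "exec W (Seq c d) s t s'"
inductive_cases exec_IfE: "exec W (IfLess x y c d) s t s'"
inductive_cases exec_WhileE: "exec W (WhileLess x y c) s t s'"

lemma exec_deterministic:
  assumes "exec W c s t s'" and "exec W c s u s''"
  shows "u = t \<and> s'' = s'"
  using assms
proof (induction arbitrary: u s'' rule: exec.induct)
  case (Seq c s t s' d t' s2)
  from Seq.prems obtain t1 s1 t2
    where *: "exec W c s t1 s1" "exec W d s1 t2 s''" "u = t1 + t2" by (blast elim: exec_SeqE)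
  then show ?case using Seq.IH by blast
next
  case (WhileTrue r x y c a t s' t' s2)
  from WhileTrue.prems have "\<exists>t1 s1 t2. exec W c (r, a) t1 s1 \<and>
      exec W (WhileLess x y c) s1 t2 s'' \<and> u = 1 + t1 + t2"
    by (cases rule: exec_WhileE) (use WhileTrue.hyps(1) in auto)
  then show ?case using WhileTrue.IH by blast
next
  case (WhileFalse r x y c a)
  from WhileFalse.prems show ?case
    by (cases rule: exec_WhileE) (use WhileFalse.hyps in auto)
next
  case (IfTrue r x y c a t s' d)
  from IfTrue.prems have "\<exists>t1. exec W c (r, a) t1 s'' \<and> u = 1 + t1"
    by (cases rule: exec_IfE) (use IfTrue.hyps(1) in auto)
  then show ?case using IfTrue.IH by blast
next
  case (IfFalse r x y d a t s' c)
  from IfFalse.prems have "\<exists>t1. exec W d (r, a) t1 s'' \<and> u = 1 + t1"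
    by (cases rule: exec_IfE) (use IfFalse.hyps(1) in auto)
  then show ?case using IfFalse.IH by blast
qed (auto elim: exec_SkipE exec_ConstE exec_AddE exec_SubE exec_LoadE exec_StoreE)


section \<open>Decision in linear time\<close>

text \<open>
  The vertices of an input graph are \<open>0, \<dots>, n - 1\<close>. The \<open>v\<close>-th list contains the
  neighbours of \<open>v\<close>, in arbitrary order.
\<close>

definition adjacency_lists :: "nat graph \<Rightarrow> nat list list \<Rightarrow> bool" where
  "adjacency_lists G L \<longleftrightarrow>
     verts G = {..<length L} \<and>
     (\<forall>v<length L. distinct (L ! v) \<and> set (L ! v) = {w. {v, w} \<in> edges G})"

text \<open>
  Register 0 holds the number of vertices and register 1 the number of edges. Array 1 is the
  concatenation of the adjacency lists, in which the list of \<open>v\<close> occupies the cells from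
  \<open>b[v]\<close> up to, but excluding, \<open>b[v + 1]\<close>, where \<open>b\<close> is array 0.
\<close>

definition input_state :: "nat list list \<Rightarrow> state" where
  "input_state L =
     ((\<lambda>_. 0)(0 := length L, 1 := length (concat L) div 2),
      (\<lambda>_ _. 0)
        (0 := \<lambda>i. if i \<le> length L then length (concat (take i L)) else 0,
         1 := \<lambda>j. if j < length (concat L) then concat L ! j else 0))"

text \<open>
  One program, one time constant and one word-length constant serve all inputs from the
  class \<open>C\<close>; nothing is required on other inputs. The words have \<open>O(log (n + m))\<close> bits.
  The answer is left in register 0.
\<close>

definition linear_time_decidable :: "(nat graph \<Rightarrow> bool) \<Rightarrow> (nat graph \<Rightarrow> bool) \<Rightarrow> bool" where
  "linear_time_decidable C Q \<longleftrightarrow>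
     (\<exists>prog c k. \<forall>G L. C G \<longrightarrow> adjacency_lists G L \<longrightarrow>
        (let n = card (verts G); m = card (edges G) in
         \<exists>t r a. exec ((n + m + 1) ^ k) prog (input_state L) t (r, a) \<and>
                 t \<le> c * (n + m) \<and> r 0 = (if Q G then 1 else 0)))"

end

(*
  Suppose d(u, v) = 5. Excluding induced copies of P3 + 2P1 forces the vertices at distance
  at least 4 from u to form a clique, likewise for v, and then also the remaining "middle"
  vertices to form a clique. Hence a vertex x at distance at most 4 from both u and v is closer
  to any vertex s than the farther one of u and v, so that every vertex farthest from s has
  eccentricity 5. Therefore two sweeps decide whether the diameter is 5: take a vertex x
  farthest from an arbitrary vertex and test whether x has eccentricity 5.
*)
theory Submission
  imports Defs
begin

section \<open>Distances\<close>

text \<open>The strict inequality behind the two sweeps is a count. If a shortest path from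
  \<open>s\<close> to \<open>v\<close> meets the middle clique at a vertex \<open>y\<close> with
  three steps left, then any \<open>x\<close> at distance at most 4 from both ends is reached from
  \<open>y\<close> in at most two: one edge inside the clique, one edge out of it. The three steps
  are available for a suitable end because the distances from \<open>s\<close> to \<open>u\<close>
  and to \<open>v\<close> add up to at least 5. The forbidden copies are of two kinds. Either the
  first three vertices of a shortest path from \<open>u\<close> are combined with two nonadjacent
  vertices further out, or a path on three middle vertices is combined with \<open>u\<close> and
  \<open>v\<close> themselves as the isolated vertices. On the machine, the bound 5 on all distances
  replaces the queue of a breadth-first search by a constant number of passes over the adjacency
  lists. Storing \<open>6 - d\<close> instead of \<open>d\<close> lets a blank cell, which is 0,
  mean "not reached yet"; truncated subtraction keeps it 0, so neither an infinite value nor an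
  initialising pass is required.\<close>

definition adj_rel :: "'a graph \<Rightarrow> ('a \<times> 'a) set" where
  "adj_rel G = {(x, y). x \<in> verts G \<and> y \<in> verts G \<and> {x, y} \<in> edges G}"

lemma adj_rel_sym: "(x, y) \<in> adj_rel G \<Longrightarrow> (y, x) \<in> adj_rel G"
  by (auto simp: adj_rel_def insert_commute)

lemma relpow_adj_rel_sym: "(x, y) \<in> adj_rel G ^^ k \<Longrightarrow> (y, x) \<in> adj_rel G ^^ k"
proof (induction k arbitrary: y)
  case (Suc k)
  then obtain z where "(x, z) \<in> adj_rel G ^^ k" "(z, y) \<in> adj_rel G" by auto
  then show ?case using Suc.IH adj_rel_sym relpow_Suc_I2 by metis
qed auto

text \<open>Trades vertex lists for powers of a relation, so that joining and cutting walks become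
  instances of \<open>relpow_add\<close>. A list of \<open>Suc k\<close> vertices makes
  \<open>k\<close> steps. Membership of \<open>u\<close> is a separate conjunct because the 0-th
  power is the identity on the whole type.\<close>

lemma walk_iff_relpow:
  "(\<exists>p. walk G u p v \<and> length p = Suc k) \<longleftrightarrow> u \<in> verts G \<and> (u, v) \<in> adj_rel G ^^ k"
proof (induction k arbitrary: u)
  case 0
  show ?case
    by (auto simp: walk_def length_Suc_conv intro: exI[of _ "[u]"])
next
  case (Suc k)
  have "(\<exists>p. walk G u p v \<and> length p = Suc (Suc k)) \<longleftrightarrow>
      (\<exists>w. (u, w) \<in> adj_rel G \<and> (\<exists>q. walk G w q v \<and> length q = Suc k))" (is "?L \<longleftrightarrow> ?R")
  proof
    assume ?L
    then obtain p where p: "walk G u p v" "length p = Suc (Suc k)" by blast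
    then obtain w q where q: "p = u # w # q"
      by (auto simp: walk_def length_Suc_conv)
    with p have "(u, w) \<in> adj_rel G" "walk G w (w # q) v" "length (w # q) = Suc k"
      by (auto simp: walk_def adj_rel_def)
    then show ?R by blast
  next
    assume ?R
    then obtain w q where q: "(u, w) \<in> adj_rel G" "walk G w q v" "length q = Suc k" by blast
    then have "walk G u (u # q) v"
      by (cases q) (auto simp: walk_def adj_rel_def)
    with q show ?L by (intro exI[of _ "u # q"]) auto
  qed
  also have "\<dots> \<longleftrightarrow> u \<in> verts G \<and> (u, v) \<in> adj_rel G ^^ Suc k"
    proof -
    have "w \<in> verts G \<and> u \<in> verts G" if "(u, w) \<in> adj_rel G" for w
      using that by (simp add: adj_rel_def)
    moreover have "(u, v) \<in> adj_rel G ^^ Suc k \<longleftrightarrow> (\<exists>w. (u, w) \<in> adj_rel G \<and> (w, v) \<in> adj_rel G ^^ k)"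
      by (metis relpow_Suc_D2 relpow_Suc_I2)
    ultimately show ?thesis unfolding Suc.IH by blast
  qed
  finally show ?case .
qed

lemma graph_dist_relpow:
  "u \<in> verts G \<Longrightarrow> graph_dist G u v = (LEAST k. (u, v) \<in> adj_rel G ^^ k)"
  by (simp add: graph_dist_def walk_iff_relpow)

lemma graph_dist_le: "u \<in> verts G \<Longrightarrow> (u, v) \<in> adj_rel G ^^ k \<Longrightarrow> graph_dist G u v \<le> k"
  by (simp add: graph_dist_relpow Least_le)

context
  fixes G :: "'a graph"
  assumes conn: "connected_graph G"
begin

lemma relpow_graph_dist:
  assumes "u \<in> verts G" "v \<in> verts G"
  shows "(u, v) \<in> adj_rel G ^^ graph_dist G u v"
proof -
  obtain p where p: "walk G u p v" using conn assms by (auto simp: connected_graph_def)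
  then have "length p = Suc (length p - 1)" by (cases p) (auto simp: walk_def)
  then have "(u, v) \<in> adj_rel G ^^ (length p - 1)" using p walk_iff_relpow by metis
  then show ?thesis using assms by (metis LeastI graph_dist_relpow)
qed

lemma graph_dist_sym:
  "u \<in> verts G \<Longrightarrow> v \<in> verts G \<Longrightarrow> graph_dist G u v = graph_dist G v u"
  by (meson antisym graph_dist_le relpow_adj_rel_sym relpow_graph_dist)

lemma graph_dist_triangle:
  assumes "u \<in> verts G" "v \<in> verts G" "w \<in> verts G"
  shows "graph_dist G u w \<le> graph_dist G u v + graph_dist G v w"
  using assms by (intro graph_dist_le) (auto simp: relpow_add intro: relpow_graph_dist)

lemma graph_dist_eq_0_iff:
  "u \<in> verts G \<Longrightarrow> v \<in> verts G \<Longrightarrow> graph_dist G u v = 0 \<longleftrightarrow> u = v"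
  using relpow_graph_dist[of u v] graph_dist_le[of u G v 0] by (auto simp del: relpow.simps(2))

lemma graph_dist_le_1:
  "u \<in> verts G \<Longrightarrow> v \<in> verts G \<Longrightarrow> {u, v} \<in> edges G \<Longrightarrow> graph_dist G u v \<le> 1"
  using graph_dist_le[of u G v 1] by (simp add: adj_rel_def)

lemma graph_dist_step:
  assumes "u \<in> verts G" "v \<in> verts G" "w \<in> verts G" "{v, w} \<in> edges G"
  shows "graph_dist G u w \<le> graph_dist G u v + 1"
  using graph_dist_triangle[of u v w] graph_dist_le_1[of v w] assms by linarith

text \<open>Source of vertices on prescribed levels. Cutting a shortest walk bounds the two
  distances by \<open>i\<close> and \<open>j\<close>; the triangle inequality forces equality in
  both.\<close>

lemma graph_dist_split:
  assumes "u \<in> verts G" "v \<in> verts G" "graph_dist G u v = i + j"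
  obtains w where "w \<in> verts G" "graph_dist G u w = i" "graph_dist G w v = j"
proof -
  obtain w where w: "(u, w) \<in> adj_rel G ^^ i" "(w, v) \<in> adj_rel G ^^ j"
    using relpow_graph_dist[OF assms(1,2)] assms(3) by (auto simp: relpow_add)
  have "w \<in> verts G" using w(1) assms(1) by (cases i) (auto simp: adj_rel_def)
  moreover from this have "graph_dist G u w \<le> i" "graph_dist G w v \<le> j"
    using w assms by (auto intro: graph_dist_le)
  ultimately show thesis
    using that graph_dist_triangle[of u w v] assms by auto
qed

lemma graph_dist_1_edge:
  assumes "u \<in> verts G" "v \<in> verts G" "graph_dist G u v = 1"
  shows "{u, v} \<in> edges G"
  using relpow_graph_dist[OF assms(1,2)] assms(3) by (simp add: adj_rel_def)

lemma graph_dist_pred: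
  assumes "u \<in> verts G" "v \<in> verts G" "graph_dist G u v = Suc i"
  obtains w where "w \<in> verts G" "graph_dist G u w = i" "{w, v} \<in> edges G"
  using graph_dist_split[of u v i 1] graph_dist_1_edge assms by (metis Suc_eq_plus1)

lemma diam_eq_iff:
  assumes "simple_graph G" "\<And>u v. u \<in> verts G \<Longrightarrow> v \<in> verts G \<Longrightarrow> graph_dist G u v \<le> d"
  shows "diam G = d \<longleftrightarrow> (\<exists>u\<in>verts G. \<exists>v\<in>verts G. graph_dist G u v = d)"
    and "diam G \<le> d"
proof -
  let ?D = "{graph_dist G u v | u v. u \<in> verts G \<and> v \<in> verts G}"
  have "?D = (\<lambda>(u, v). graph_dist G u v) ` (verts G \<times> verts G)" by auto
  then have fin: "finite ?D" using assms(1) by (simp add: simple_graph_def)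
  have ne: "?D \<noteq> {}" using conn by (force simp: connected_graph_def)
  show "diam G \<le> d" using fin ne assms(2) by (auto simp: diam_def)
  show "diam G = d \<longleftrightarrow> (\<exists>u\<in>verts G. \<exists>v\<in>verts G. graph_dist G u v = d)"
  proof -
    have "\<forall>a\<in>?D. a \<le> d" using assms(2) by auto
    then have "diam G = d \<longleftrightarrow> d \<in> ?D"
      unfolding diam_def using Max_eq_iff[OF fin ne, of d] by blast
    also have "d \<in> ?D \<longleftrightarrow> (\<exists>u\<in>verts G. \<exists>v\<in>verts G. graph_dist G u v = d)" by blast
    finally show ?thesis .
  qed
qed

end


section \<open>Graphs without induced \<open>P\<^sub>3 + 2P\<^sub>1\<close>\<close>

lemma verts_P3_2P1: "verts P3_2P1 = {Inl 0, Inl 1, Inl 2, Inr (Inl 0), Inr (Inr 0)}"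
  by (auto simp: P3_2P1_def disjoint_union_def path_graph_def)

lemma edges_P3_2P1: "edges P3_2P1 = {{Inl 0, Inl 1}, {Inl 1, Inl 2}}"
proof -
  have "edges (path_graph 3) = {{0, 1}, {1, 2}}"
    by (auto simp: path_graph_def numeral_3_eq_3 less_Suc_eq numeral_2_eq_2)
  moreover have "edges (path_graph 1) = {}" by (auto simp: path_graph_def)
  ultimately show ?thesis by (simp add: P3_2P1_def disjoint_union_def)
qed

lemma induced_freeD:
  assumes "simple_graph G" "induced_free P3_2P1 G"
    and "{a, b, c, d, e} \<subseteq> verts G" "distinct [a, b, c, d, e]"
    and "{a, b} \<in> edges G" "{b, c} \<in> edges G" "{a, c} \<notin> edges G" "{d, e} \<notin> edges G"
    and "\<And>x. x \<in> {a, b, c} \<Longrightarrow> {x, d} \<notin> edges G \<and> {x, e} \<notin> edges G"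
  shows False
proof -
  define f :: "'a \<Rightarrow> nat + nat + nat" where
    "f x = (if x = a then Inl 0 else if x = b then Inl 1 else if x = c then Inl 2
            else if x = d then Inr (Inl 0) else Inr (Inr 0))" for x
  have f: "f a = Inl 0" "f b = Inl 1" "f c = Inl 2" "f d = Inr (Inl 0)" "f e = Inr (Inr 0)"
    using assms(4) by (auto simp: f_def)
  \<comment> \<open>\<open>graph_iso\<close> also compares the pairs with \<open>u = v\<close>, so
    singletons must be excluded as edges.\<close>
  have loop: "{x} \<notin> edges G" for x
    using assms(1) by (fastforce simp: simple_graph_def)
  have "bij_betw f {a, b, c, d, e} (verts P3_2P1)"
    using assms(4) by (auto simp: bij_betw_def inj_on_def verts_P3_2P1 f)
  moreover have "\<forall>x\<in>{a, b, c, d, e}. \<forall>y\<in>{a, b, c, d, e}.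
      {x, y} \<in> edges (induced_subgraph G {a, b, c, d, e}) \<longleftrightarrow> {f x, f y} \<in> edges P3_2P1"
    using assms(5-8) assms(9)[of a] assms(9)[of b] assms(9)[of c] loop
    by (simp add: f edges_P3_2P1 induced_subgraph_def doubleton_eq_iff insert_commute)
  ultimately have "graph_iso (induced_subgraph G {a, b, c, d, e}) P3_2P1"
    unfolding graph_iso_def by (intro exI[of _ f]) (simp add: induced_subgraph_def)
  then show False using assms(2,3) by (auto simp: induced_free_def)
qed

text \<open>Converse reading of the forbidden pattern, for showing that a concrete graph belongs to
  the class.\<close>

lemma not_induced_freeE:
  assumes "\<not> induced_free P3_2P1 G"
  obtains a b c d e where "{a, b, c, d, e} \<subseteq> verts G" "distinct [a, b, c, d, e]"
    "{a, b} \<in> edges G" "{b, c} \<in> edges G" "{a, c} \<notin> edges G" "{d, e} \<notin> edges G"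
    "\<forall>x\<in>{a, b, c}. {x, d} \<notin> edges G \<and> {x, e} \<notin> edges G"
proof -
  obtain S where S: "S \<subseteq> verts G" "graph_iso (induced_subgraph G S) P3_2P1"
    using assms unfolding induced_free_def by blast
  then obtain f where f: "bij_betw f S (verts P3_2P1)"
    and iso: "\<forall>u\<in>S. \<forall>v\<in>S. {u, v} \<in> edges (induced_subgraph G S) \<longleftrightarrow> {f u, f v} \<in> edges P3_2P1"
    unfolding graph_iso_def by (auto simp: induced_subgraph_def)
  define g where "g = inv_into S f"
  have g: "g y \<in> S" "f (g y) = y" if "y \<in> verts P3_2P1" for y
    using that f unfolding g_def
    by (auto simp: bij_betw_def inv_into_into f_inv_into_f)
  have inj: "g x \<noteq> g y" if "x \<in> verts P3_2P1" "y \<in> verts P3_2P1" "x \<noteq> y" for x y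
    using that g by metis
  have e: "{g x, g y} \<in> edges G \<longleftrightarrow> {x, y} \<in> edges P3_2P1"
    if "x \<in> verts P3_2P1" "y \<in> verts P3_2P1" for x y
  proof -
    have "{g x, g y} \<in> edges (induced_subgraph G S) \<longleftrightarrow> {x, y} \<in> edges P3_2P1"
      using iso g that by metis
    then show ?thesis using g(1) that by (simp add: induced_subgraph_def)
  qed
  let ?a = "Inl 0" and ?b = "Inl 1" and ?c = "Inl 2" and ?d = "Inr (Inl 0)" and ?e = "Inr (Inr 0)"
  have V: "?a \<in> verts P3_2P1" "?b \<in> verts P3_2P1" "?c \<in> verts P3_2P1"
    "?d \<in> verts P3_2P1" "?e \<in> verts P3_2P1"
    by (simp_all add: verts_P3_2P1)
  show thesis
  proof (rule that)
    show "{g ?a, g ?b, g ?c, g ?d, g ?e} \<subseteq> verts G" using S(1) g(1) V by blast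
    show "distinct [g ?a, g ?b, g ?c, g ?d, g ?e]"
      using V by (simp add: inj)
    show "{g ?a, g ?b} \<in> edges G" "{g ?b, g ?c} \<in> edges G" "{g ?a, g ?c} \<notin> edges G"
      "{g ?d, g ?e} \<notin> edges G"
      using V by (simp_all add: e edges_P3_2P1 doubleton_eq_iff)
    show "\<forall>x\<in>{g ?a, g ?b, g ?c}. {x, g ?d} \<notin> edges G \<and> {x, g ?e} \<notin> edges G"
      using V by (auto simp: e edges_P3_2P1 doubleton_eq_iff)
  qed
qed

text \<open>For ends at distance 5, the triangle inequality turns the two upper bounds into both
  distances lying in \<open>{2, 3}\<close>. What remains outside are the vertices at distance at
  least 4 from one of the ends.\<close>

definition middle :: "'a graph \<Rightarrow> 'a \<Rightarrow> 'a \<Rightarrow> 'a set" where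
  "middle G u v = {z \<in> verts G. graph_dist G u z \<le> 3 \<and> graph_dist G v z \<le> 3}"

lemma connected_free_graphD:
  assumes "connected_free_graph H G"
  shows "simple_graph G" "connected_graph G" "induced_free H G"
  using assms by (auto simp: connected_free_graph_def)

section \<open>The diameter bound and the structure around a pair at distance 5\<close>

context
  fixes G :: "'a graph"
  assumes G: "connected_free_graph P3_2P1 G"
begin

private lemmas simple = connected_free_graphD(1)[OF G]
private lemmas conn = connected_free_graphD(2)[OF G]
private lemmas free = connected_free_graphD(3)[OF G]

text \<open>An edge changes the distance from \<open>u\<close> by at most one. Hence vertices on
  levels 4 and 6 are nonadjacent to each other and to the levels 0, 1, 2, where a shortest path
  supplies the three-vertex path.\<close>

lemma graph_dist_le_5:
  assumes "u \<in> verts G" "v \<in> verts G"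
  shows "graph_dist G u v \<le> 5"
proof (rule ccontr)
  note d = graph_dist_split[OF conn]
  assume "\<not> ?thesis"
  then obtain v6 where v6: "v6 \<in> verts G" "graph_dist G u v6 = 6"
    using d[of u v 6 "graph_dist G u v - 6"] assms by auto
  obtain v4 where v4: "v4 \<in> verts G" "graph_dist G u v4 = 4" using d[of u v6 4 2] assms v6 by auto
  obtain v2 where v2: "v2 \<in> verts G" "graph_dist G u v2 = 2" using d[of u v4 2 2] assms v4 by auto
  obtain v1 where v1: "v1 \<in> verts G" "graph_dist G u v1 = 1" "{v1, v2} \<in> edges G"
    using graph_dist_pred[OF conn, of u v2 1] assms v2 by auto
  have u: "graph_dist G u u = 0" using graph_dist_eq_0_iff[OF conn] assms by simp
  have step: "graph_dist G u y \<le> graph_dist G u x + 1"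
    if "{x, y} \<in> edges G" "x \<in> verts G" "y \<in> verts G" for x y
    using graph_dist_step[OF conn] assms that by blast
  show False
  proof (rule induced_freeD[OF simple free, of u v1 v2 v4 v6])
    show "{u, v1} \<in> edges G" using graph_dist_1_edge[OF conn] assms v1 by blast
    show "distinct [u, v1, v2, v4, v6]" using u v1 v2 v4 v6 by auto
  qed (use assms v1 v2 v4 v6 u in \<open>auto dest!: step\<close>)
qed

text \<open>
  Otherwise \<open>u\<close>, \<open>y\<close> and a common neighbour of them would induce \<open>P\<^sub>3 + 2P\<^sub>1\<close> together
  with \<open>z\<close> and \<open>z'\<close>.
\<close>

lemma edge_beyond_path:
  assumes V: "u \<in> verts G" "y \<in> verts G" "z \<in> verts G" "z' \<in> verts G"
    and d: "graph_dist G u y = 2" "graph_dist G u z \<ge> 3" "graph_dist G u z' \<ge> 3"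
    and "{y, z} \<notin> edges G" "{y, z'} \<notin> edges G" "z \<noteq> z'"
  shows "{z, z'} \<in> edges G"
proof (rule ccontr)
  assume nadj: "\<not> ?thesis"
  obtain x where x: "x \<in> verts G" "graph_dist G u x = 1" "{x, y} \<in> edges G"
    using graph_dist_pred[OF conn, of u y 1] V d by auto
  have u: "graph_dist G u u = 0" using graph_dist_eq_0_iff[OF conn] V by simp
  have step: "graph_dist G u q \<le> graph_dist G u p + 1"
    if "{p, q} \<in> edges G" "p \<in> verts G" "q \<in> verts G" for p q
    using graph_dist_step[OF conn] V that by blast
  show False
  proof (rule induced_freeD[OF simple free, of u x y z z'])
    show "{u, x} \<in> edges G" using graph_dist_1_edge[OF conn] V x by blast
    show "distinct [u, x, y, z, z']" using u x d assms(10) by auto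
  qed (use assms x u nadj in \<open>auto dest!: step\<close>)
qed

context
  fixes u v
  assumes uv: "u \<in> verts G" "v \<in> verts G" "graph_dist G u v = 5"
begin

lemma dist_sum: "z \<in> verts G \<Longrightarrow> graph_dist G u z + graph_dist G v z \<ge> 5"
  using graph_dist_triangle[OF conn, of u z v] graph_dist_sym[OF conn, of z v] uv by simp

text \<open>A vertex on level 2 of a shortest path to \<open>v\<close> has no neighbour on level 4
  or beyond, so \<open>edge_beyond_path\<close> applies to every such pair. Since \<open>v\<close>
  is itself that far out, the lemma also places each vertex at distance at least 4 from
  \<open>u\<close> within one step of \<open>v\<close>.\<close>

lemma far_clique:
  assumes "z \<in> verts G" "z' \<in> verts G" "graph_dist G u z \<ge> 4" "graph_dist G u z' \<ge> 4" "z \<noteq> z'"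
  shows "{z, z'} \<in> edges G"
proof -
  obtain y where y: "y \<in> verts G" "graph_dist G u y = 2"
    using graph_dist_split[OF conn, of u v 2 3] uv by auto
  have "{y, w} \<notin> edges G" if "w \<in> verts G" "graph_dist G u w \<ge> 4" for w
    using graph_dist_step[OF conn, of u y w] uv that y by auto
  then show ?thesis using edge_beyond_path[of u y z z'] assms uv y by auto
qed

text \<open>Here \<open>v\<close> serves as the second outer vertex: it is adjacent to neither
  \<open>b\<close> nor \<open>c\<close>, so a missing edge between \<open>b\<close> and
  \<open>c\<close> would let \<open>edge_beyond_path\<close> produce the impossible edge between
  \<open>c\<close> and \<open>v\<close>.\<close>

lemma level_2_3:
  assumes "b \<in> middle G u v" "c \<in> middle G u v" "graph_dist G u b = 2" "graph_dist G u c = 3"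
  shows "{b, c} \<in> edges G"
proof (rule ccontr)
  assume nadj: "\<not> ?thesis"
  have b: "b \<in> verts G" and c: "c \<in> verts G" "graph_dist G v c \<le> 3"
    using assms by (auto simp: middle_def)
  have v: "graph_dist G v v = 0" using graph_dist_eq_0_iff[OF conn] uv by simp
  have "graph_dist G v b \<ge> 3" "graph_dist G v c \<ge> 2" using dist_sum b c assms by force+
  then have "{v, c} \<notin> edges G" "{b, v} \<notin> edges G" "c \<noteq> v"
    using graph_dist_le_1[OF conn] b c uv v by (force simp: insert_commute)+
  then show False
    using edge_beyond_path[of u b c v] assms b c uv nadj by (auto simp: insert_commute)
qed

end

lemma middle_commute: "middle G u v = middle G v u"
  by (auto simp: middle_def)

text \<open>Different levels are completely joined by \<open>level_2_3\<close>. A nonadjacent pair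
  therefore shares a level, and any vertex \<open>y\<close> of the other level is a common
  neighbour; the path through \<open>y\<close> avoids all neighbours of \<open>u\<close> and
  \<open>v\<close>.\<close>

lemma middle_clique:
  assumes uv: "u \<in> verts G" "v \<in> verts G" "graph_dist G u v = 5"
    and z: "z \<in> middle G u v" "z' \<in> middle G u v" "z \<noteq> z'"
  shows "{z, z'} \<in> edges G"
proof (rule ccontr)
  assume nadj: "\<not> ?thesis"
  have vu: "graph_dist G v u = 5" using uv graph_dist_sym[OF conn] by metis
  have in_middle: "w \<in> verts G \<and> graph_dist G u w \<in> {2, 3} \<and> graph_dist G v w \<in> {2, 3}"
    if "w \<in> middle G u v" for w
    using that dist_sum[OF uv, of w] by (auto simp: middle_def)
  have level: "{b, c} \<in> edges G"
    if "b \<in> middle G u v" "c \<in> middle G u v" "graph_dist G u b \<noteq> graph_dist G u c" for b c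
    using level_2_3[OF uv, of b c] level_2_3[OF uv, of c b] in_middle[OF that(1)] in_middle[OF that(2)] that
    by (auto simp: insert_commute)
  have same: "graph_dist G u z = graph_dist G u z'" using level nadj z by blast
  have "\<exists>y \<in> middle G u v. graph_dist G u y = i" if "i \<in> {2, 3}" for i
  proof -
    have "graph_dist G u v = i + (5 - i)" using uv that by auto
    then obtain y where "y \<in> verts G" "graph_dist G u y = i" "graph_dist G y v = 5 - i"
      using graph_dist_split[OF conn, of u v] uv by blast
    then show ?thesis
      using that uv graph_dist_sym[OF conn, of y v] by (auto simp: middle_def)
  qed
  \<comment> \<open>\<open>5 - _\<close> exchanges the levels 2 and 3; a shortest path from
    \<open>u\<close> to \<open>v\<close> meets both.\<close>
  moreover have "5 - graph_dist G u z \<in> {2, 3}" using in_middle[OF z(1)] by auto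
  ultimately obtain y where y: "y \<in> middle G u v" "graph_dist G u y = 5 - graph_dist G u z" by blast
  have ne: "graph_dist G u y \<noteq> graph_dist G u z" using y(2) in_middle[OF z(1)] by auto
  have e: "{z, y} \<in> edges G" "{y, z'} \<in> edges G" using level[OF z(1) y(1)] level[OF y(1) z(2)] ne same by simp_all
  have far: "{w, u} \<notin> edges G \<and> {w, v} \<notin> edges G" if "w \<in> middle G u v" for w
    using in_middle[OF that] graph_dist_le_1[OF conn, of u w] graph_dist_le_1[OF conn, of v w] uv
    by (auto simp: insert_commute)
  have refl: "graph_dist G u u = 0" "graph_dist G v v = 0" using graph_dist_eq_0_iff[OF conn] uv by auto
  show False
  proof (rule induced_freeD[OF simple free, of z y z' u v])
    show "{u, v} \<notin> edges G" using graph_dist_le_1[OF conn, of u v] uv by auto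
    show "distinct [z, y, z', u, v]"
      using in_middle[OF z(1)] in_middle[OF y(1)] in_middle[OF z(2)] z(3) refl ne same uv by auto
    show "{x, u} \<notin> edges G \<and> {x, v} \<notin> edges G" if "x \<in> {z, y, z'}" for x
      using that far y(1) z by blast
    show "{z, y, z', u, v} \<subseteq> verts G" using in_middle y(1) z uv by blast
  qed (use nadj e in simp_all)
qed

text \<open>A vertex at distance 4 from one end is within one step of the other end by
  \<open>far_clique\<close>. Its predecessor on the way from the first end is then at distances 3
  and at most 2, hence in the middle.\<close>

lemma dist_middle:
  assumes uv: "u \<in> verts G" "v \<in> verts G" "graph_dist G u v = 5"
    and x: "x \<in> verts G" "graph_dist G u x \<le> 4" "graph_dist G v x \<le> 4"
  shows "\<exists>y \<in> middle G u v. graph_dist G x y \<le> 1"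
proof -
  have vu: "graph_dist G v u = 5" using uv graph_dist_sym[OF conn] by metis
  have *: "\<exists>y \<in> middle G p q. graph_dist G x y \<le> 1"
    if pq: "p \<in> verts G" "q \<in> verts G" "graph_dist G p q = 5" "graph_dist G p x = 4" "graph_dist G q x \<le> 4"
    for p q
  proof -
    obtain y where y: "y \<in> verts G" "graph_dist G p y = 3" "{y, x} \<in> edges G"
      using graph_dist_pred[OF conn, of p x 3] pq x by auto
    have "graph_dist G q x \<le> 1"
      using far_clique[OF pq(1-3), of x q] graph_dist_le_1[OF conn, of q x] graph_dist_eq_0_iff[OF conn, of q x]
        pq x by (cases "x = q") (auto simp: insert_commute)
    then have "y \<in> middle G p q"
      using graph_dist_step[OF conn, of q x y] pq x y by (auto simp: middle_def insert_commute)
    then show ?thesis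
      using graph_dist_le_1[OF conn, of x y] x y by (auto simp: insert_commute)
  qed
  show ?thesis
  proof (cases "graph_dist G u x = 4 \<or> graph_dist G v x = 4")
    case True
    then show ?thesis
      using *[of u v] *[of v u] uv vu x by (auto simp: middle_commute)
  next
    case False
    then have "x \<in> middle G u v" using x by (auto simp: middle_def)
    moreover have "graph_dist G x x \<le> 1" using graph_dist_eq_0_iff[OF conn, of x x] x by simp
    ultimately show ?thesis by blast
  qed
qed

text \<open>
  A shortest path from \<open>s\<close> to \<open>v\<close> enters the middle clique 3 steps before \<open>v\<close>, and \<open>x\<close> is at
  distance at most 1 from that clique.
\<close>

lemma closer_than_end:
  assumes uv: "u \<in> verts G" "v \<in> verts G" "graph_dist G u v = 5"
    and s: "s \<in> verts G" "graph_dist G v s \<ge> 3"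
    and x: "x \<in> verts G" "graph_dist G u x \<le> 4" "graph_dist G v x \<le> 4"
  shows "graph_dist G s x < graph_dist G v s"
proof -
  have vu: "graph_dist G v u = 5" using uv graph_dist_sym[OF conn] by metis
  have le1: "graph_dist G a b \<le> 1"
    if "a \<in> verts G" "b \<in> verts G" "a \<noteq> b \<Longrightarrow> {a, b} \<in> edges G" for a b
    using that graph_dist_le_1[OF conn, of a b] graph_dist_eq_0_iff[OF conn, of a b] by (cases "a = b") auto
  obtain x' where x': "x' \<in> middle G u v" "graph_dist G x x' \<le> 1" "x' \<in> verts G"
    using dist_middle[OF uv x] by (auto simp: middle_def)
  obtain y where y: "y \<in> verts G" "graph_dist G s y = graph_dist G v s - 3" "graph_dist G y v = 3"
    using graph_dist_split[OF conn, of s v "graph_dist G v s - 3" 3] graph_dist_sym[OF conn, of s v] s uv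
    by auto
  have "graph_dist G v y = 3" using y uv graph_dist_sym[OF conn, of y v] by simp
  \<comment> \<open>Otherwise \<open>far_clique\<close> would put \<open>y\<close> within one step
    of \<open>v\<close>, contrary to distance 3.\<close>
  moreover have "graph_dist G u y \<le> 3"
    using far_clique[OF uv, of y v] uv y graph_dist_le_1[OF conn, of y v] graph_dist_eq_0_iff[OF conn, of v v]
    by fastforce
  ultimately have "y \<in> middle G u v" using y by (simp add: middle_def)
  then have "graph_dist G y x' \<le> 1"
    using le1 y x' middle_clique[OF uv] by blast
  \<comment> \<open>The three summands are at most \<open>graph_dist G v s - 3\<close>, 1 and 1;
    distance at least 3 makes the subtraction exact.\<close>
  moreover have "graph_dist G s x \<le> graph_dist G s y + graph_dist G y x' + graph_dist G x' x"
    using graph_dist_triangle[OF conn, of s y x] graph_dist_triangle[OF conn, of y x' x] s x y x' by linarith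
  moreover have "graph_dist G x' x \<le> 1" using x' x graph_dist_sym[OF conn, of x x'] by simp
  ultimately show ?thesis using y s by linarith
qed

text \<open>If \<open>x\<close> had distance at most 4 to both ends, then whichever end is at
  distance at least 3 from \<open>s\<close> would be farther from \<open>s\<close> than
  \<open>x\<close>, by \<open>closer_than_end\<close>.\<close>

lemma farthest_vertex:
  assumes uv: "u \<in> verts G" "v \<in> verts G" "graph_dist G u v = 5"
    and s: "s \<in> verts G"
    and x: "x \<in> verts G" "\<And>y. y \<in> verts G \<Longrightarrow> graph_dist G s y \<le> graph_dist G s x"
  shows "\<exists>y\<in>verts G. graph_dist G x y = 5"
proof (rule ccontr)
  assume "\<not> ?thesis"
  moreover have vu: "graph_dist G v u = 5" using uv graph_dist_sym[OF conn] by metis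
  ultimately have "graph_dist G x u \<noteq> 5" "graph_dist G x v \<noteq> 5" using uv by auto
  then have d: "graph_dist G u x \<le> 4" "graph_dist G v x \<le> 4"
    using graph_dist_le_5[of x u] graph_dist_le_5[of x v] graph_dist_sym[OF conn, of x] uv x by force+
  have "graph_dist G u s \<ge> 3 \<or> graph_dist G v s \<ge> 3"
    using dist_sum[OF uv s] by linarith
  then have "\<exists>y\<in>{u, v}. graph_dist G s x < graph_dist G y s"
    using closer_than_end[OF uv s _ x(1) d] closer_than_end[OF uv(2,1) vu s _ x(1) d(2,1)] by blast
  then show False
    using x(2) uv s graph_dist_sym[OF conn] by (metis insertE leD singletonD)
qed

text \<open>Holds for every start \<open>s\<close> and every choice of farthest vertices, so the
  program may start anywhere and break ties arbitrarily.\<close>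

lemma diam_5_iff_farthest:
  assumes s: "s \<in> verts G"
    and x: "x \<in> verts G" "\<And>y. y \<in> verts G \<Longrightarrow> graph_dist G s y \<le> graph_dist G s x"
    and x': "x' \<in> verts G" "\<And>y. y \<in> verts G \<Longrightarrow> graph_dist G x y \<le> graph_dist G x x'"
  shows "diam G = 5 \<longleftrightarrow> graph_dist G x x' = 5"
proof -
  have "diam G = 5 \<longleftrightarrow> (\<exists>u\<in>verts G. \<exists>v\<in>verts G. graph_dist G u v = 5)"
    by (rule diam_eq_iff[OF conn simple graph_dist_le_5])
  also have "\<dots> \<longleftrightarrow> (\<exists>y\<in>verts G. graph_dist G x y = 5)"
    using farthest_vertex[OF _ _ _ s x] x(1) by blast
  also have "\<dots> \<longleftrightarrow> graph_dist G x x' = 5"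
    using x' x(1) graph_dist_le_5 by (metis antisym)
  finally show ?thesis .
qed

end

section \<open>Sharpness: the path on six vertices has diameter 5\<close>

lemma path_graph_edge_iff:
  "{a, b} \<in> edges (path_graph k) \<longleftrightarrow> a < k \<and> b < k \<and> (b = Suc a \<or> a = Suc b)"
  by (auto simp: path_graph_def doubleton_eq_iff)

lemma path_graph_relpow_le:
  "(x, y) \<in> adj_rel (path_graph k) ^^ j \<Longrightarrow> y \<le> x + j"
proof (induction j arbitrary: y)
  case (Suc j)
  then obtain z where "(x, z) \<in> adj_rel (path_graph k) ^^ j" "(z, y) \<in> adj_rel (path_graph k)" by auto
  then show ?case using Suc.IH[of z] by (auto simp: adj_rel_def path_graph_edge_iff)
qed auto

lemma connected_path_graph:
  assumes "k > 0"
  shows "connected_graph (path_graph k)"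
proof -
  have *: "(0, v) \<in> adj_rel (path_graph k) ^^ v" if "v < k" for v
    using that
  proof (induction v)
    case (Suc v)
    then have "(v, Suc v) \<in> adj_rel (path_graph k)"
      by (simp add: adj_rel_def path_graph_edge_iff) (simp add: path_graph_def)
    with Suc show ?case by auto
  qed auto
  \<comment> \<open>A detour through vertex 0 suffices, since only connectivity is at stake.\<close>
  have "(u, v) \<in> adj_rel (path_graph k) ^^ (u + v)" if "u < k" "v < k" for u v
    using *[OF that(1), THEN relpow_adj_rel_sym] *[OF that(2)] by (auto simp: relpow_add)
  then have "\<exists>p. walk (path_graph k) u p v" if "u < k" "v < k" for u v
    using that walk_iff_relpow[of "path_graph k" u v "u + v"] by (auto simp: path_graph_def)
  then show ?thesis using assms by (auto simp: connected_graph_def path_graph_def)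
qed

text \<open>An induced three-vertex path consists of \<open>b\<close> and its two neighbours, and
  the isolated vertices must differ from \<open>b\<close> by at least 3. Among six labels this
  leaves candidates on one side of \<open>b\<close> only, at most two, and two such are consecutive,
  hence adjacent.\<close>

lemma induced_free_path_graph_6: "induced_free P3_2P1 (path_graph 6)"
proof (rule ccontr)
  assume "\<not> ?thesis"
  then obtain a b c d e where V: "{a, b, c, d, e} \<subseteq> verts (path_graph 6)"
    and dist: "distinct [a, b, c, d, e]"
    and E: "{a, b} \<in> edges (path_graph 6)" "{b, c} \<in> edges (path_graph 6)"
      "{a, c} \<notin> edges (path_graph 6)" "{d, e} \<notin> edges (path_graph 6)"
    and N: "\<forall>x\<in>{a, b, c}. {x, d} \<notin> edges (path_graph 6) \<and> {x, e} \<notin> edges (path_graph 6)"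
    by (rule not_induced_freeE)
  have lt: "a < 6" "b < 6" "c < 6" "d < 6" "e < 6" using V by (auto simp: path_graph_def)
  have abc: "a = Suc b \<and> b = Suc c \<or> c = Suc b \<and> b = Suc a"
    using E(1,2) dist unfolding path_graph_edge_iff by auto
  have far: "w + 3 \<le> b \<or> b + 3 \<le> w"
    if "w < 6" "w \<noteq> a" "w \<noteq> b" "w \<noteq> c" "{a, w} \<notin> edges (path_graph 6)" "{c, w} \<notin> edges (path_graph 6)" for w
    using abc
    by (elim disjE conjE) (use that lt in \<open>simp_all add: path_graph_edge_iff, presburger+\<close>)
  have "d + 3 \<le> b \<or> b + 3 \<le> d" by (rule far) (use N dist lt in auto)
  moreover have "e + 3 \<le> b \<or> b + 3 \<le> e" by (rule far) (use N dist lt in auto)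
  moreover have "d \<noteq> e" "d \<noteq> Suc e" "e \<noteq> Suc d" using E(4) dist lt unfolding path_graph_edge_iff by auto
  ultimately show False
    using abc lt by linarith
qed

lemma d_max_P3_2P1: "d_max (connected_free_graph P3_2P1) = 5"
proof (rule antisym)
  have "diam G \<le> 5" if G: "connected_free_graph P3_2P1 G" for G :: "nat graph"
    using diam_eq_iff(2)[OF connected_free_graphD(2)[OF G] connected_free_graphD(1)[OF G] graph_dist_le_5[OF G]] .
  then show "d_max (connected_free_graph P3_2P1) \<le> 5"
    by (auto simp: d_max_def numeral_eq_enat intro!: Sup_least)
next
  let ?P = "path_graph 6"
  have "simple_graph ?P" by (auto simp: simple_graph_def path_graph_def)
  then have P: "connected_free_graph P3_2P1 ?P"
    by (simp add: connected_free_graph_def connected_path_graph induced_free_path_graph_6)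
  have V: "0 \<in> verts ?P" "5 \<in> verts ?P" by (auto simp: path_graph_def)
  have "graph_dist ?P 0 5 \<ge> 5"
    using path_graph_relpow_le[OF relpow_graph_dist[OF connected_free_graphD(2)[OF P] V]] by simp
  then have "diam ?P = 5"
    using diam_eq_iff(1)[OF connected_free_graphD(2)[OF P] connected_free_graphD(1)[OF P] graph_dist_le_5[OF P]] graph_dist_le_5[OF P V] V
    by (meson antisym)
  then show "5 \<le> d_max (connected_free_graph P3_2P1)"
    using P unfolding d_max_def by (intro Sup_upper) (force simp: numeral_eq_enat)
qed


section \<open>A calculus for timed executions\<close>

text \<open>Total correctness: termination and absence of overflow are part of \<open>exec\<close>.
  The elapsed time is an argument of \<open>Q\<close>, so composing programs merely shifts that
  argument.\<close>

definition wp where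
  "wp W c Q r a \<longleftrightarrow> (\<exists>t r' a'. exec W c (r, a) t (r', a') \<and> Q t r' a')"

lemma wp_atomic:
  "wp W Skip Q r a \<longleftrightarrow> Q 1 r a"
  "wp W (Const x v) Q r a \<longleftrightarrow> v \<le> W \<and> Q 1 (r(x := v)) a"
  "wp W (Add x y z) Q r a \<longleftrightarrow> r y + r z \<le> W \<and> Q 1 (r(x := r y + r z)) a"
  "wp W (Sub x y z) Q r a \<longleftrightarrow> r y - r z \<le> W \<and> Q 1 (r(x := r y - r z)) a"
  "wp W (Load x b y) Q r a \<longleftrightarrow> Q 1 (r(x := a b (r y))) a"
  "wp W (Store b y x) Q r a \<longleftrightarrow> Q 1 r (a(b := (a b)(r y := r x)))"
  unfolding wp_def
  by (auto elim!: exec_SkipE exec_ConstE exec_AddE exec_SubE exec_LoadE exec_StoreE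
      intro!: exec.intros exI)

lemma wp_IfLess:
  "wp W (IfLess x y c d) Q r a \<longleftrightarrow>
     (if r x < r y then wp W c (\<lambda>t. Q (1 + t)) r a else wp W d (\<lambda>t. Q (1 + t)) r a)"
proof (cases "r x < r y")
  case True
  have "exec W (IfLess x y c d) (r, a) t s' \<longleftrightarrow> (\<exists>t'. t = 1 + t' \<and> exec W c (r, a) t' s')" for t s'
  proof
    assume "exec W (IfLess x y c d) (r, a) t s'"
    then show "\<exists>t'. t = 1 + t' \<and> exec W c (r, a) t' s'"
      by (rule exec_IfE) (use True in auto)
  next
    assume "\<exists>t'. t = 1 + t' \<and> exec W c (r, a) t' s'"
    then show "exec W (IfLess x y c d) (r, a) t s'"
      using exec.IfTrue[of r x y, OF True] by blast
  qed
  with True show ?thesis unfolding wp_def by auto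
next
  case False
  have "exec W (IfLess x y c d) (r, a) t s' \<longleftrightarrow> (\<exists>t'. t = 1 + t' \<and> exec W d (r, a) t' s')" for t s'
  proof
    assume "exec W (IfLess x y c d) (r, a) t s'"
    then show "\<exists>t'. t = 1 + t' \<and> exec W d (r, a) t' s'"
      by (rule exec_IfE) (use False in auto)
  next
    assume "\<exists>t'. t = 1 + t' \<and> exec W d (r, a) t' s'"
    then show "exec W (IfLess x y c d) (r, a) t s'"
      using exec.IfFalse[of r x y, OF False] by blast
  qed
  with False show ?thesis unfolding wp_def by auto
qed

lemma wp_Seq: "wp W (Seq c d) Q r a \<longleftrightarrow> wp W c (\<lambda>t. wp W d (\<lambda>t'. Q (t + t'))) r a"
  unfolding wp_def by (auto elim!: exec_SeqE) (metis exec.Seq)+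

lemma wp_mono:
  "wp W c P r a \<Longrightarrow> (\<And>t r a. P t r a \<Longrightarrow> Q t r a) \<Longrightarrow> wp W c Q r a"
  unfolding wp_def by blast

text \<open>The cost \<open>f i\<close> may vary with the iteration, which is what lets a loop over
  vertices be charged the sum of the degrees. Each iteration pays 1 for its test, and the leading 1
  pays for the failing test.\<close>

lemma wp_for:
  assumes "I l r a" "l \<le> N"
    and counter: "\<And>i r a. I i r a \<Longrightarrow> r x = i \<and> r y = N"
    and step: "\<And>i r a. l \<le> i \<Longrightarrow> i < N \<Longrightarrow> I i r a \<Longrightarrow> wp W c (\<lambda>t r a. t \<le> f i \<and> I (Suc i) r a) r a"
  shows "wp W (WhileLess x y c) (\<lambda>t r a. t \<le> 1 + (\<Sum>i=l..<N. 1 + f i) \<and> I N r a) r a"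
  using assms(2,1,4)
\<comment> \<open>The induction descends from \<open>N\<close>, so its base case is the exit of the
  loop.\<close>
proof (induction l arbitrary: r a rule: inc_induct)
  case base
  then have "\<not> r x < r y" using counter by force
  then have "exec W (WhileLess x y c) (r, a) 1 (r, a)" by (rule exec.WhileFalse)
  then show ?case using base unfolding wp_def by fastforce
next
  case (step l)
  have less: "r x < r y" using step.hyps counter[OF step.prems(1)] by simp
  obtain t1 r1 a1 where 1: "exec W c (r, a) t1 (r1, a1)" "t1 \<le> f l" "I (Suc l) r1 a1"
    using step.prems(2)[OF _ _ step.prems(1)] step.hyps unfolding wp_def by auto
  obtain t2 r2 a2 where 2: "exec W (WhileLess x y c) (r1, a1) t2 (r2, a2)"
    "t2 \<le> 1 + (\<Sum>i=Suc l..<N. 1 + f i)" "I N r2 a2"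
    using step.IH[OF 1(3)] step.prems(2) unfolding wp_def by fastforce
  have "exec W (WhileLess x y c) (r, a) (1 + t1 + t2) (r2, a2)"
    by (rule exec.WhileTrue[OF less 1(1) 2(1)])
  moreover have "1 + t1 + t2 \<le> 1 + (\<Sum>i=l..<N. 1 + f i)"
    using 1(2) 2(2) step.hyps by (simp add: sum.atLeast_Suc_lessThan)
  ultimately show ?case using 2(3) unfolding wp_def by blast
qed

lemma wp_SeqI:
  assumes "wp W c P r a" "\<And>t r a. P t r a \<Longrightarrow> wp W d (\<lambda>t'. Q (t + t')) r a"
  shows "wp W (Seq c d) Q r a"
  unfolding wp_Seq using wp_mono assms by metis

lemmas wp_simps = wp_atomic wp_IfLess wp_Seq


section \<open>Linear-time computation of a farthest vertex\<close>

text \<open>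
  Register 0 is \<open>n\<close>, register 2 the current vertex, registers 3 and 4 delimit the unread part
  of its adjacency list, register 6 accumulates a maximum, register 8 holds 1, register 10
  holds 0, and register 9 the source of a sweep, which is overwritten by a farthest vertex.
  Array \<open>A\<close> converges from below to \<open>6 - d\<close>, where \<open>d\<close> is the distance from the source. Since
  no distance exceeds 5, five rounds of in-place relaxation suffice.
\<close>

definition fold_neighbours :: "nat \<Rightarrow> com" where
  "fold_neighbours A = WhileLess 3 4 (Seq (Load 5 1 3) (Seq (Load 5 A 5) (Seq (Sub 5 5 8)
     (Seq (IfLess 6 5 (Add 6 5 10) Skip) (Add 3 3 8)))))"

definition relax_vertex :: "nat \<Rightarrow> com" where
  "relax_vertex A = Seq (Load 3 0 2) (Seq (Add 7 2 8) (Seq (Load 4 0 7) (Seq (Load 6 A 2)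
     (Seq (fold_neighbours A) (Seq (Store A 2 6) (Add 2 2 8))))))"

definition relax_all :: "nat \<Rightarrow> com" where
  "relax_all A = Seq (Const 2 0) (WhileLess 2 0 (relax_vertex A))"

text \<open>Minimising \<open>6 - d\<close> maximises \<open>d\<close>. Adding register 10, which
  holds 0, serves as a copy instruction.\<close>

definition find_min :: "nat \<Rightarrow> com" where
  "find_min A = Seq (Const 2 0) (WhileLess 2 0 (Seq (Load 5 A 2) (Seq (Load 6 A 9)
     (Seq (IfLess 5 6 (Add 9 2 10) Skip) (Add 2 2 8)))))"

text \<open>The five rounds are unrolled into the program text. The array is expected to be blank,
  hence a separate array for each sweep.\<close>

definition sweep :: "nat \<Rightarrow> com" where
  "sweep A = Seq (Const 6 6) (Seq (Store A 9 6)
     (Seq ((Seq (relax_all A) ^^ 5) Skip) (find_min A)))"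

text \<open>The final cell holds \<open>6 - d\<close> for the eccentricity \<open>d\<close> of the
  vertex found first; as \<open>d\<close> is at most 5, a value below 2 means exactly
  \<open>d = 5\<close>.\<close>

definition diam_5_program :: com where
  "diam_5_program = Seq (Const 8 1) (Seq (sweep 2) (Seq (sweep 3)
     (Seq (Load 5 3 9) (Seq (Const 6 2) (IfLess 5 6 (Const 0 1) (Const 0 0))))))"

section \<open>Positions in the concatenated adjacency lists\<close>

definition offset :: "'a list list \<Rightarrow> nat \<Rightarrow> nat" where
  "offset L i = length (concat (take i L))"

lemma offset_0 [simp]: "offset L 0 = 0"
  by (simp add: offset_def)

lemma offset_length [simp]: "offset L (length L) = length (concat L)"
  by (simp add: offset_def)

lemma offset_Suc: "v < length L \<Longrightarrow> offset L (Suc v) = offset L v + length (L ! v)"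
  by (simp add: offset_def take_Suc_conv_app_nth)

lemma concat_split: "v < length L \<Longrightarrow> concat L = concat (take v L) @ L ! v @ concat (drop (Suc v) L)"
  by (metis concat.simps(2) concat_append id_take_nth_drop)

lemma offset_Suc_le: "v < length L \<Longrightarrow> offset L (Suc v) \<le> length (concat L)"
  using arg_cong[OF concat_split, of v L length] by (simp add: offset_def take_Suc_conv_app_nth del: length_concat)

lemma nth_concat_offset:
  "v < length L \<Longrightarrow> i < length (L ! v) \<Longrightarrow> concat L ! (offset L v + i) = L ! v ! i"
  by (subst concat_split[of v]) (auto simp: offset_def nth_append simp del: length_concat)

lemma sum_length_nth: "(\<Sum>v<length L. length (L ! v)) = length (concat L)"
  by (simp add: length_concat sum_list_sum_nth lessThan_atLeast0)

definition ready :: "nat list list \<Rightarrow> (nat \<Rightarrow> nat) \<Rightarrow> (nat \<Rightarrow> nat \<Rightarrow> nat) \<Rightarrow> bool" where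
  "ready L r a \<longleftrightarrow> r 0 = length L \<and> r 8 = 1 \<and> r 10 = 0 \<and>
     (\<forall>i\<le>length L. a 0 i = offset L i) \<and> (\<forall>j<length (concat L). a 1 j = concat L ! j)"

text \<open>Isolates what the sweep uses about distances from \<open>x\<close>:
  \<open>neighbour\<close> keeps stored values from overshooting \<open>6 - d\<close>,
  \<open>predecessor\<close> gives progress in each round. The bounds on \<open>W\<close> cover the
  constant 6, the vertex counters and the list positions.\<close>

locale sweep_input =
  fixes L :: "nat list list" and d :: "nat \<Rightarrow> nat" and x W :: nat
  assumes x: "x < length L"
    and dist_0: "\<And>v. v < length L \<Longrightarrow> d v = 0 \<longleftrightarrow> v = x"
    and dist_5: "\<And>v. v < length L \<Longrightarrow> d v \<le> 5"
    and neighbour: "\<And>v w. v < length L \<Longrightarrow> w \<in> set (L ! v) \<Longrightarrow> w < length L \<and> d v \<le> d w + 1"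
    and predecessor: "\<And>v i. v < length L \<Longrightarrow> d v = Suc i \<Longrightarrow> \<exists>w\<in>set (L ! v). d w = i"
    and W: "6 \<le> W" "length L \<le> W" "length (concat L) \<le> W"
begin

text \<open>
  The state of the array after \<open>k\<close> complete rounds and the relaxation of the first \<open>i\<close>
  vertices in the next one.
\<close>

definition approx :: "nat \<Rightarrow> nat \<Rightarrow> (nat \<Rightarrow> nat) \<Rightarrow> bool" where
  "approx k i R \<longleftrightarrow> (\<forall>v<length L. R v \<le> 6 - d v) \<and>
     (\<forall>v<length L. d v \<le> k \<or> d v \<le> Suc k \<and> v < i \<longrightarrow> 6 - d v \<le> R v)"

text \<open>\<open>m\<close> is the maximum of \<open>R v\<close> and all \<open>R w - 1\<close>,
  split into bound and attainment: attainment yields the upper estimate on the new value, the bound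
  yields its lower estimate.\<close>

definition relaxed :: "(nat \<Rightarrow> nat) \<Rightarrow> nat \<Rightarrow> nat \<Rightarrow> bool" where
  "relaxed R v m \<longleftrightarrow> R v \<le> m \<and> (\<forall>w\<in>set (L ! v). R w - 1 \<le> m) \<and>
     (m = R v \<or> (\<exists>w\<in>set (L ! v). m = R w - 1))"

lemma approx_le: "approx k i R \<Longrightarrow> v < length L \<Longrightarrow> R v \<le> W"
  using W(1) by (fastforce simp: approx_def)

text \<open>In-place updating is harmless because the upper estimate holds for old and new cells
  alike. If \<open>d i\<close> is at most \<open>Suc k\<close>, a predecessor of \<open>i\<close>
  has distance at most \<open>k\<close> and so already carries its final value.\<close>

lemma approx_relaxed:
  assumes R: "approx k i R" and i: "i < length L" and m: "relaxed R i m"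
  shows "approx k (Suc i) (R(i := m))"
proof -
  have up: "R v \<le> 6 - d v" if "v < length L" for v using R that by (simp add: approx_def)
  have low: "6 - d v \<le> R v" if "v < length L" "d v \<le> k" for v using R that by (simp add: approx_def)
  have "m \<le> 6 - d i"
  proof (cases "m = R i")
    case False
    then obtain w where w: "w \<in> set (L ! i)" "m = R w - 1" using m by (auto simp: relaxed_def)
    then show ?thesis using up[of w] neighbour[OF i, of w] by auto
  qed (use up i in auto)
  moreover have "6 - d i \<le> m" if "d i \<le> Suc k"
  proof (cases "d i")
    case 0
    then show ?thesis using low[of i] i m by (auto simp: relaxed_def)
  next
    case (Suc j)
    then obtain w where w: "w \<in> set (L ! i)" "d w = j" using predecessor i by blast
    then show ?thesis
      using low[of w] neighbour[OF i, of w] that Suc m by (fastforce simp: relaxed_def)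
  qed
  ultimately show ?thesis using R by (auto simp: approx_def less_Suc_eq)
qed

lemma approx_round: "approx k (length L) R \<Longrightarrow> approx (Suc k) 0 R"
  by (auto simp: approx_def)

lemma wp_fold_neighbours:
  assumes r: "ready L r a" "v < length L" "r 3 = offset L v" "r 4 = offset L (Suc v)" "r 6 = a A v"
    and R: "\<And>w. w < length L \<Longrightarrow> a A w \<le> W"
  shows "wp W (fold_neighbours A) (\<lambda>t r' a'. t \<le> 1 + 7 * length (L ! v) \<and> a' = a \<and>
    (\<forall>q. q \<notin> {3, 5, 6} \<longrightarrow> r' q = r q) \<and> relaxed (a A) v (r' 6)) r a"
proof -
  \<comment> \<open>\<open>relaxed\<close> restricted to the cells read before position
    \<open>j\<close>. The body costs 6 steps, and the test makes 7 per list entry.\<close>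
  define I where "I j r' a' \<longleftrightarrow> a' = a \<and> (\<forall>q. q \<notin> {3, 5, 6} \<longrightarrow> r' q = r q) \<and> r' 3 = j \<and>
    a A v \<le> r' 6 \<and> (\<forall>i. offset L v + i < j \<longrightarrow> a A (L ! v ! i) - 1 \<le> r' 6) \<and>
    (r' 6 = a A v \<or> (\<exists>w\<in>set (L ! v). r' 6 = a A w - 1))" for j r' a'
  have "wp W (fold_neighbours A)
      (\<lambda>t r' a'. t \<le> 1 + (\<Sum>j=offset L v..<offset L (Suc v). 1 + 6) \<and> I (offset L (Suc v)) r' a') r a"
    unfolding fold_neighbours_def
  proof (rule wp_for)
    show "I (offset L v) r a" using r by (auto simp: I_def)
    show "offset L v \<le> offset L (Suc v)" using r by (simp add: offset_Suc)
    show "r' 3 = j \<and> r' 4 = offset L (Suc v)" if "I j r' a'" for j r' a'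
      using that r by (auto simp: I_def)
    fix j r' a' assume j: "offset L v \<le> j" "j < offset L (Suc v)" and I: "I j r' a'"
    define i where "i = j - offset L v"
    have i: "j = offset L v + i" "i < length (L ! v)" using j r by (auto simp: i_def offset_Suc)
    have jlen: "j < length (concat L)" using j offset_Suc_le[OF r(2)] by linarith
    have w: "a (Suc 0) (offset L v + i) = L ! v ! i"
      using r jlen i by (simp add: ready_def nth_concat_offset)
    have wset: "L ! v ! i \<in> set (L ! v)" using i by simp
    have aw: "a A (L ! v ! i) \<le> W" using R neighbour[OF r(2) wset] by blast
    have regs: "r' 8 = 1" "r' 10 = 0" "r' 3 = j" "a' = a" using I r by (auto simp: I_def ready_def)
    show "wp W (Seq (Load 5 1 3) (Seq (Load 5 A 5) (Seq (Sub 5 5 8)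
      (Seq (IfLess 6 5 (Add 6 5 10) Skip) (Add 3 3 8))))) (\<lambda>t r a. t \<le> 6 \<and> I (Suc j) r a) r' a'"
      using I aw wset jlen W i unfolding I_def
      by (auto simp: wp_simps regs w less_Suc_eq)
  qed
  then show ?thesis
  proof (rule wp_mono)
    fix t :: nat and r' a'
    assume *: "t \<le> 1 + (\<Sum>j=offset L v..<offset L (Suc v). 1 + 6) \<and> I (offset L (Suc v)) r' a'"
    then have "\<forall>w\<in>set (L ! v). a A w - 1 \<le> r' 6"
      using r(2) by (auto simp: I_def offset_Suc in_set_conv_nth)
    then show "t \<le> 1 + 7 * length (L ! v) \<and> a' = a \<and>
        (\<forall>q. q \<notin> {3, 5, 6} \<longrightarrow> r' q = r q) \<and> relaxed (a A) v (r' 6)"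
      using * r(2) by (auto simp: I_def relaxed_def offset_Suc)
  qed
qed

lemma wp_relax_vertex:
  assumes r: "ready L r a" "v < length L" "r 2 = v" and A: "A \<ge> 2"
    and R: "approx k v (a A)"
  shows "wp W (relax_vertex A) (\<lambda>t r' a'. t \<le> 7 + 7 * length (L ! v) \<and> ready L r' a' \<and>
    r' 2 = Suc v \<and> r' 9 = r 9 \<and> (\<forall>B. B \<noteq> A \<longrightarrow> a' B = a B) \<and> approx k (Suc v) (a' A)) r a"
proof -
  have b: "a 0 v = offset L v" "a 0 (Suc v) = offset L (Suc v)" "r 8 = 1"
    using r by (auto simp: ready_def)
  \<comment> \<open>Registers after the four set-up instructions, whose cost is added back at the
    end.\<close>
  define r0 where "r0 = r(3 := offset L v, 7 := Suc v, 4 := offset L (Suc v), 6 := a A v)"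
  have "ready L r0 a" using r by (simp add: ready_def r0_def)
  then have fold: "wp W (fold_neighbours A) (\<lambda>t r' a'. t \<le> 1 + 7 * length (L ! v) \<and> a' = a \<and>
    (\<forall>q. q \<notin> {3, 5, 6} \<longrightarrow> r' q = r0 q) \<and> relaxed (a A) v (r' 6)) r0 a"
    using r approx_le[OF R] by (intro wp_fold_neighbours) (auto simp: r0_def ready_def)
  have "wp W (Seq (fold_neighbours A) (Seq (Store A 2 6) (Add 2 2 8)))
     (\<lambda>t r' a'. t \<le> 3 + 7 * length (L ! v) \<and> ready L r' a' \<and>
    r' 2 = Suc v \<and> r' 9 = r 9 \<and> (\<forall>B. B \<noteq> A \<longrightarrow> a' B = a B) \<and> approx k (Suc v) (a' A)) r0 a"
    using r b A W approx_relaxed[OF R r(2)]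
    by (intro wp_SeqI[OF fold]) (auto simp: wp_simps r0_def ready_def)
  then have "wp W (Seq (fold_neighbours A) (Seq (Store A 2 6) (Add 2 2 8)))
     (\<lambda>t r' a'. 4 + t \<le> 7 + 7 * length (L ! v) \<and> ready L r' a' \<and>
    r' 2 = Suc v \<and> r' 9 = r 9 \<and> (\<forall>B. B \<noteq> A \<longrightarrow> a' B = a B) \<and> approx k (Suc v) (a' A)) r0 a"
    by (rule wp_mono) auto
  then show ?thesis
    unfolding relax_vertex_def wp_Seq[of _ "Load _ _ _"] wp_Seq[of _ "Add _ _ _"] wp_atomic
    using r b W unfolding r0_def by simp
qed

text \<open>Linearity of a round: the vertex costs are constant plus proportional to the list
  length, and the list lengths sum to \<open>length (concat L)\<close>.\<close>

lemma wp_relax_all: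
  assumes r: "ready L r a" and A: "A \<ge> 2" and R: "approx k 0 (a A)"
  shows "wp W (relax_all A) (\<lambda>t r' a'. t \<le> 2 + 8 * length L + 7 * length (concat L) \<and> ready L r' a' \<and>
    r' 9 = r 9 \<and> (\<forall>B. B \<noteq> A \<longrightarrow> a' B = a B) \<and> approx (Suc k) 0 (a' A)) r a"
proof -
  define I where "I i r' a' \<longleftrightarrow> ready L r' a' \<and> r' 2 = i \<and> r' 9 = r 9 \<and>
    (\<forall>B. B \<noteq> A \<longrightarrow> a' B = a B) \<and> approx k i (a' A)" for i r' a'
  have "wp W (WhileLess 2 0 (relax_vertex A)) (\<lambda>t r' a'.
      t \<le> 1 + (\<Sum>i=0..<length L. 1 + (7 + 7 * length (L ! i))) \<and> I (length L) r' a') (r(2 := 0)) a"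
  proof (rule wp_for)
    show "I 0 (r(2 := 0)) a" using r R by (auto simp: I_def ready_def)
    show "r' 2 = i \<and> r' 0 = length L" if "I i r' a'" for i r' a'
      using that by (auto simp: I_def ready_def)
    fix i r' a' assume "i < length L" "I i r' a'"
    then have "wp W (relax_vertex A) (\<lambda>t r'' a''. t \<le> 7 + 7 * length (L ! i) \<and> ready L r'' a'' \<and>
        r'' 2 = Suc i \<and> r'' 9 = r' 9 \<and> (\<forall>B. B \<noteq> A \<longrightarrow> a'' B = a' B) \<and> approx k (Suc i) (a'' A)) r' a'"
      using A by (intro wp_relax_vertex) (auto simp: I_def)
    then show "wp W (relax_vertex A) (\<lambda>t r a. t \<le> 7 + 7 * length (L ! i) \<and> I (Suc i) r a) r' a'"
      by (rule wp_mono) (use \<open>I i r' a'\<close> in \<open>auto simp: I_def\<close>)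
  qed auto
  moreover have "(\<Sum>i=0..<length L. 1 + (7 + 7 * length (L ! i))) = 8 * length L + 7 * length (concat L)"
    by (simp add: sum.distrib sum_length_nth[symmetric] sum_distrib_left atLeast0LessThan del: length_concat)
  ultimately show ?thesis
    unfolding relax_all_def wp_Seq[of _ "Const _ _"] wp_atomic
    by (auto simp: I_def intro: approx_round elim!: wp_mono simp del: length_concat)
qed

lemma wp_relax_rounds:
  assumes "ready L r a" and A: "A \<ge> 2" and "approx k 0 (a A)"
  shows "wp W ((Seq (relax_all A) ^^ j) Skip) (\<lambda>t r' a'.
    t \<le> 1 + j * (2 + 8 * length L + 7 * length (concat L)) \<and> ready L r' a' \<and>
    r' 9 = r 9 \<and> (\<forall>B. B \<noteq> A \<longrightarrow> a' B = a B) \<and> approx (k + j) 0 (a' A)) r a"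
  using assms(1,3)
proof (induction j arbitrary: k r a)
  case 0
  then show ?case by (simp add: wp_simps)
next
  case (Suc j)
  let ?T = "2 + 8 * length L + 7 * length (concat L)"
  show ?case
    unfolding funpow.simps comp_def
  proof (rule wp_SeqI[OF wp_relax_all[OF Suc.prems(1) A Suc.prems(2)]])
    fix t1 r1 a1
    assume 1: "t1 \<le> ?T \<and> ready L r1 a1 \<and> r1 9 = r 9 \<and> (\<forall>B. B \<noteq> A \<longrightarrow> a1 B = a B) \<and>
      approx (Suc k) 0 (a1 A)"
    then have "wp W ((Seq (relax_all A) ^^ j) Skip) (\<lambda>t r' a'. t \<le> 1 + j * ?T \<and> ready L r' a' \<and>
        r' 9 = r1 9 \<and> (\<forall>B. B \<noteq> A \<longrightarrow> a' B = a1 B) \<and> approx (Suc k + j) 0 (a' A)) r1 a1"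
      by (intro Suc.IH) auto
    then show "wp W ((Seq (relax_all A) ^^ j) Skip) (\<lambda>t' r' a'. t1 + t' \<le> 1 + Suc j * ?T \<and>
        ready L r' a' \<and> r' 9 = r 9 \<and> (\<forall>B. B \<noteq> A \<longrightarrow> a' B = a B) \<and> approx (k + Suc j) 0 (a' A)) r1 a1"
      by (rule wp_mono) (use 1 in auto)
  qed
qed

lemma wp_find_min:
  assumes r: "ready L r a" "r 9 < length L"
  shows "wp W (find_min A) (\<lambda>t r' a'. t \<le> 2 + 6 * length L \<and> ready L r' a' \<and> a' = a \<and>
    r' 9 < length L \<and> (\<forall>v<length L. a A (r' 9) \<le> a A v)) r a"
proof -
  define I where "I i r' a' \<longleftrightarrow> ready L r' a' \<and> a' = a \<and> r' 2 = i \<and> r' 9 < length L \<and>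
    (\<forall>v<i. a A (r' 9) \<le> a A v)" for i r' a'
  have "wp W (WhileLess 2 0 (Seq (Load 5 A 2) (Seq (Load 6 A 9)
     (Seq (IfLess 5 6 (Add 9 2 10) Skip) (Add 2 2 8))))) (\<lambda>t r' a'.
      t \<le> 1 + (\<Sum>i=0..<length L. 1 + 5) \<and> I (length L) r' a') (r(2 := 0)) a"
  proof (rule wp_for)
    show "I 0 (r(2 := 0)) a" using r by (auto simp: I_def ready_def)
    show "r' 2 = i \<and> r' 0 = length L" if "I i r' a'" for i r' a'
      using that by (auto simp: I_def ready_def)
    fix i r' a' assume i: "i < length L" "I i r' a'"
    have "\<forall>v<i. a A i \<le> a A v" if "a A i < a A (r' 9)"
      using i(2) that by (auto simp: I_def intro: less_imp_le[OF less_le_trans])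
    with i show "wp W (Seq (Load 5 A 2) (Seq (Load 6 A 9) (Seq (IfLess 5 6 (Add 9 2 10) Skip) (Add 2 2 8))))
        (\<lambda>t r a. t \<le> 5 \<and> I (Suc i) r a) r' a'"
      using W(2) by (auto simp: I_def ready_def wp_simps less_Suc_eq)
  qed auto
  then show ?thesis
    unfolding find_min_def wp_Seq[of _ "Const _ _"] wp_atomic
    by (auto simp: I_def elim!: wp_mono)
qed

lemma wp_sweep:
  assumes r: "ready L r a" "r 9 = x" "a A = (\<lambda>_. 0)" and A: "A \<ge> 2"
  shows "wp W (sweep A) (\<lambda>t r' a'. t \<le> 16 + 46 * length L + 35 * length (concat L) \<and> ready L r' a' \<and>
    (\<forall>B. B \<noteq> A \<longrightarrow> a' B = a B) \<and> r' 9 < length L \<and> a' A (r' 9) = 6 - d (r' 9) \<and>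
    (\<forall>v<length L. d v \<le> d (r' 9))) r a"
proof -
  let ?r = "r(6 := 6)" and ?a = "a(A := (a A)(x := 6))"
  have init: "ready L ?r ?a" "approx 0 0 (?a A)"
  proof -
    show "ready L ?r ?a" using r(1) A by (simp add: ready_def)
    have "d x = 0" using dist_0 x by simp
    then show "approx 0 0 (?a A)" by (simp add: approx_def r(3) dist_0)
  qed
  have "wp W (Seq ((Seq (relax_all A) ^^ 5) Skip) (find_min A)) (\<lambda>t r' a'.
      t \<le> 13 + 46 * length L + 35 * length (concat L) \<and> ready L r' a' \<and>
    (\<forall>B. B \<noteq> A \<longrightarrow> a' B = a B) \<and> r' 9 < length L \<and> a' A (r' 9) = 6 - d (r' 9) \<and>
    (\<forall>v<length L. d v \<le> d (r' 9))) ?r ?a"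
  proof (rule wp_SeqI[OF wp_relax_rounds[OF init(1) A init(2)]])
    fix t r1 a1
    assume 1: "t \<le> 1 + 5 * (2 + 8 * length L + 7 * length (concat L)) \<and> ready L r1 a1 \<and>
      r1 9 = ?r 9 \<and> (\<forall>B. B \<noteq> A \<longrightarrow> a1 B = ?a B) \<and> approx (0 + 5) 0 (a1 A)"
    \<comment> \<open>After five rounds the lower estimate covers all vertices, since no distance
      exceeds 5, and it meets the upper estimate.\<close>
    then have lim: "a1 A v = 6 - d v" if "v < length L" for v
      using that dist_5[OF that] by (intro antisym) (simp_all add: approx_def)
    have "wp W (find_min A) (\<lambda>t r' a'. t \<le> 2 + 6 * length L \<and> ready L r' a' \<and> a' = a1 \<and>
        r' 9 < length L \<and> (\<forall>v<length L. a1 A (r' 9) \<le> a1 A v)) r1 a1"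
      using 1 r x by (intro wp_find_min) auto
    then show "wp W (find_min A) (\<lambda>t' r' a'. t + t' \<le> 13 + 46 * length L + 35 * length (concat L) \<and>
        ready L r' a' \<and> (\<forall>B. B \<noteq> A \<longrightarrow> a' B = a B) \<and> r' 9 < length L \<and> a' A (r' 9) = 6 - d (r' 9) \<and>
        (\<forall>v<length L. d v \<le> d (r' 9))) r1 a1"
    proof (rule wp_mono)
      fix t' r' a'
      assume 2: "t' \<le> 2 + 6 * length L \<and> ready L r' a' \<and> a' = a1 \<and>
        r' 9 < length L \<and> (\<forall>v<length L. a1 A (r' 9) \<le> a1 A v)"
      then have x': "r' 9 < length L" by simp
      \<comment> \<open>Truncation in \<open>6 - d v\<close> cannot occur because \<open>d v\<close>
        is at most 5, so the order is genuinely reversed.\<close>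
      have "d v \<le> d (r' 9)" if "v < length L" for v
      proof -
        have "a1 A (r' 9) \<le> a1 A v" using 2 that by simp
        then show ?thesis unfolding lim[OF that] lim[OF x'] using dist_5[OF that] by linarith
      qed
      then show "t + t' \<le> 13 + 46 * length L + 35 * length (concat L) \<and>
          ready L r' a' \<and> (\<forall>B. B \<noteq> A \<longrightarrow> a' B = a B) \<and> r' 9 < length L \<and> a' A (r' 9) = 6 - d (r' 9) \<and>
          (\<forall>v<length L. d v \<le> d (r' 9))"
        using 1 2 lim[OF x'] by (elim conjE) simp
    qed
  qed
  then have "wp W (Seq ((Seq (relax_all A) ^^ 5) Skip) (find_min A)) (\<lambda>t r' a'.
      2 + t \<le> 16 + 46 * length L + 35 * length (concat L) \<and> ready L r' a' \<and>
    (\<forall>B. B \<noteq> A \<longrightarrow> a' B = a B) \<and> r' 9 < length L \<and> a' A (r' 9) = 6 - d (r' 9) \<and>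
    (\<forall>v<length L. d v \<le> d (r' 9))) ?r ?a"
    by (rule wp_mono) (auto simp del: length_concat)
  then show ?thesis
    unfolding sweep_def wp_Seq[of _ "Const _ _"] wp_Seq[of _ "Store _ _ _"] wp_atomic
    using r W by simp
qed

end


section \<open>The decision procedure\<close>

text \<open>Handshake argument: list entries are ordered pairs of adjacent vertices, and an edge
  arises from at most two ordered pairs.\<close>

lemma length_concat_adjacency_lists:
  assumes G: "simple_graph G" and L: "adjacency_lists G L"
  shows "length (concat L) \<le> 2 * card (edges G)"
proof -
  have V: "verts G = {..<length L}" using L by (simp add: adjacency_lists_def)
  have "edges G \<subseteq> Pow (verts G)" using G by (auto simp: simple_graph_def)
  then have fin: "finite (edges G)" using V finite_subset[of "edges G" "Pow (verts G)"] by simp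
  let ?P = "\<lambda>e. {(v, w). {v, w} = e}"
  have P: "finite (?P e) \<and> card (?P e) \<le> 2" if "e \<in> edges G" for e
  proof -
    have "card e = 2" using G that by (simp add: simple_graph_def)
    then obtain p q where "e = {p, q}" by (auto simp: card_2_iff)
    then have sub: "?P e \<subseteq> {(p, q), (q, p)}" by (auto simp: doubleton_eq_iff)
    have "card (?P e) \<le> card {(p, q), (q, p)}" by (rule card_mono[OF _ sub]) simp
    also have "\<dots> \<le> 2" by (cases "p = q") auto
    finally show ?thesis using finite_subset[OF sub] by simp
  qed
  have "length (concat L) = (\<Sum>v<length L. card (set (L ! v)))"
    unfolding sum_length_nth[symmetric]
    using L by (intro sum.cong refl distinct_card[symmetric]) (simp add: adjacency_lists_def)
  also have "\<dots> = card (SIGMA v:{..<length L}. set (L ! v))" by simp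
  also have "\<dots> \<le> card (\<Union>e\<in>edges G. ?P e)"
  proof (rule card_mono)
    show "finite (\<Union>e\<in>edges G. ?P e)" using fin P by simp
    show "(SIGMA v:{..<length L}. set (L ! v)) \<subseteq> (\<Union>e\<in>edges G. ?P e)"
    proof (clarify)
      fix v w assume "v < length L" "w \<in> set (L ! v)"
      then have "{v, w} \<in> edges G" using L by (simp add: adjacency_lists_def)
      then show "(v, w) \<in> (\<Union>e\<in>edges G. ?P e)" by simp
    qed
  qed
  also have "\<dots> \<le> (\<Sum>e\<in>edges G. card (?P e))" by (rule card_UN_le[OF fin])
  also have "\<dots> \<le> (\<Sum>e\<in>edges G. 2)" using P by (intro sum_mono) simp
  finally show ?thesis by (simp del: length_concat)
qed

lemma sweep_input_graph_dist:
  assumes G: "connected_free_graph P3_2P1 G" and L: "adjacency_lists G L" and x: "x < length L"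
    and W: "6 \<le> W" "length L \<le> W" "length (concat L) \<le> W"
  shows "sweep_input L (graph_dist G x) x W"
proof -
  note conn = connected_free_graphD(2)[OF G]
  have V: "verts G = {..<length L}" using L by (simp add: adjacency_lists_def)
  have nbr: "w \<in> set (L ! v) \<longleftrightarrow> {v, w} \<in> edges G" if "v < length L" for v w
    using L that by (simp add: adjacency_lists_def)
  show ?thesis
  proof
    show "(graph_dist G x v = 0) = (v = x)" if "v < length L" for v
      using graph_dist_eq_0_iff[OF conn, of x v] x that V by auto
    show "graph_dist G x v \<le> 5" if "v < length L" for v
      using graph_dist_le_5[OF G] x that V by simp
    show "w < length L \<and> graph_dist G x v \<le> graph_dist G x w + 1" if "v < length L" "w \<in> set (L ! v)" for v w
    proof -
      have e: "{v, w} \<in> edges G" using that nbr by simp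
      then have "w < length L" using connected_free_graphD(1)[OF G] V by (auto simp: simple_graph_def)
      then show ?thesis
        using graph_dist_step[OF conn, of x w v] e x that V by (simp add: insert_commute)
    qed
    show "\<exists>w\<in>set (L ! v). graph_dist G x w = i" if v: "v < length L" "graph_dist G x v = Suc i" for v i
    proof -
      obtain w where "w \<in> verts G" "graph_dist G x w = i" "{w, v} \<in> edges G"
        using graph_dist_pred[OF conn, of x v i] x v V by auto
      then show ?thesis using nbr[OF v(1)] by (auto simp: insert_commute)
    qed
  qed (use x W in auto)
qed

lemma wp_diam_5_program:
  assumes G: "connected_free_graph P3_2P1 G" and L: "adjacency_lists G L"
    and W: "6 \<le> W" "length L \<le> W" "length (concat L) \<le> W"
  shows "wp W diam_5_program (\<lambda>t r a. t \<le> 37 + 92 * length L + 70 * length (concat L) \<and>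
    r 0 = (if diam G = 5 then 1 else 0)) (fst (input_state L)) (snd (input_state L))"
proof -
  have V: "verts G = {..<length L}" using L by (simp add: adjacency_lists_def)
  then have ne: "0 < length L" using connected_free_graphD(2)[OF G] by (auto simp: connected_graph_def)
  let ?T = "16 + 46 * length L + 35 * length (concat L)"
  define r0 where "r0 = (fst (input_state L))(8 := 1)"
  define a0 where "a0 = snd (input_state L)"
  \<comment> \<open>Register 9 is initially 0, so the first sweep starts at vertex 0; arrays 2 and 3
    are blank.\<close>
  have init: "ready L r0 a0" "r0 9 = 0" "a0 2 = (\<lambda>_. 0)" "a0 3 = (\<lambda>_. 0)"
    by (auto simp: r0_def a0_def input_state_def ready_def offset_def)
  let ?final = "Seq (Load 5 3 9) (Seq (Const 6 2) (IfLess 5 6 (Const 0 1) (Const 0 0)))"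
  have "wp W (Seq (sweep 2) (Seq (sweep 3) ?final))
    (\<lambda>t r a. t \<le> 2 * ?T + 4 \<and> r 0 = (if diam G = 5 then 1 else 0)) r0 a0"
  proof (rule wp_SeqI[OF sweep_input.wp_sweep[OF sweep_input_graph_dist[OF G L ne W] init(1-3)]])
    fix t1 r1 a1
    assume 1: "t1 \<le> ?T \<and> ready L r1 a1 \<and> (\<forall>B. B \<noteq> 2 \<longrightarrow> a1 B = a0 B) \<and> r1 9 < length L \<and>
      a1 2 (r1 9) = 6 - graph_dist G 0 (r1 9) \<and> (\<forall>v<length L. graph_dist G 0 v \<le> graph_dist G 0 (r1 9))"
    define x where "x = r1 9"
    have x: "x < length L" using 1 by (simp add: x_def)
    show "wp W (Seq (sweep 3) ?final)
      (\<lambda>t r a. t1 + t \<le> 2 * ?T + 4 \<and> r 0 = (if diam G = 5 then 1 else 0)) r1 a1"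
    \<comment> \<open>The source is now the vertex left in register 9. Array 3 is still blank
      because the first sweep changed array 2 only.\<close>
    proof (rule wp_SeqI[OF sweep_input.wp_sweep[OF sweep_input_graph_dist[OF G L x W], of _ _ 3]])
      fix t2 r2 a2
      assume 2: "t2 \<le> ?T \<and> ready L r2 a2 \<and> (\<forall>B. B \<noteq> 3 \<longrightarrow> a2 B = a1 B) \<and> r2 9 < length L \<and>
        a2 3 (r2 9) = 6 - graph_dist G x (r2 9) \<and> (\<forall>v<length L. graph_dist G x v \<le> graph_dist G x (r2 9))"
      have "diam G = 5 \<longleftrightarrow> graph_dist G x (r2 9) = 5"
        using diam_5_iff_farthest[OF G, of 0 x "r2 9"] 1 2 ne V by (simp add: x_def)
      moreover have "graph_dist G x (r2 9) \<le> 5" using graph_dist_le_5[OF G] 2 x V by simp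
      ultimately have "diam G = 5 \<longleftrightarrow> a2 3 (r2 9) < 2" using 2 by auto
      then show "wp W ?final (\<lambda>t r a. t1 + (t2 + t) \<le> 2 * ?T + 4 \<and>
          r 0 = (if diam G = 5 then 1 else 0)) r2 a2"
        using 1 2 W by (auto simp: wp_simps simp del: length_concat)
    qed (use 1 init in \<open>auto simp: x_def\<close>)
  qed simp
  then have "wp W (Seq (sweep 2) (Seq (sweep 3) ?final)) (\<lambda>t r a.
      1 + t \<le> 37 + 92 * length L + 70 * length (concat L) \<and> r 0 = (if diam G = 5 then 1 else 0)) r0 a0"
    by (rule wp_mono) (auto simp del: length_concat)
  then show ?thesis
    unfolding diam_5_program_def wp_Seq[of _ "Const 8 1"] wp_atomic
    using W by (simp add: r0_def a0_def)
qed

lemma linear_time_diam_5: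
  "linear_time_decidable (connected_free_graph P3_2P1) (\<lambda>G. diam G = 5)"
  unfolding linear_time_decidable_def
proof (intro exI allI impI)
  fix G L
  assume G: "connected_free_graph P3_2P1 G" and L: "adjacency_lists G L"
  define n m where "n = card (verts G)" and "m = card (edges G)"
  \<comment> \<open>Exponent 3 accommodates the constant 6 even for a single vertex, where
    \<open>n + m + 1\<close> is 2 and its square only 4.\<close>
  define W where "W = (n + m + 1) ^ 3"
  have V: "verts G = {..<length L}" using L by (simp add: adjacency_lists_def)
  then have n: "length L = n" "n \<ge> 1"
    using connected_free_graphD(2)[OF G] by (auto simp: n_def connected_graph_def Suc_le_eq)
  have m: "length (concat L) \<le> 2 * m"
    using length_concat_adjacency_lists[OF connected_free_graphD(1)[OF G] L] by (simp add: m_def)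
  have "2 ^ 2 \<le> (n + m + 1) ^ 2" using n by (intro power_mono) auto
  then have "4 * (n + m + 1) \<le> (n + m + 1) ^ 2 * (n + m + 1)" by (intro mult_right_mono) auto
  then have "4 * (n + m + 1) \<le> W" unfolding W_def by (simp only: power3_eq_cube power2_eq_square)
  then have "4 * n + 4 * m + 4 \<le> W" by simp
  then have W: "6 \<le> W" "length L \<le> W" "length (concat L) \<le> W"
    using n m by - (linarith, linarith, linarith)
  obtain t r a where *: "exec W diam_5_program (input_state L) t (r, a)"
    "t \<le> 37 + 92 * length L + 70 * length (concat L)" "r 0 = (if diam G = 5 then 1 else 0)"
    using wp_diam_5_program[OF G L W] by (auto simp: wp_def)
  \<comment> \<open>The coefficient of \<open>m\<close> is \<open>70 * 2\<close>, as each edge fills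
    two list cells; the additive 37 is absorbed by \<open>n\<close>, which is at least 1.\<close>
  have "t \<le> 140 * n + 140 * m" using *(2) n m by linarith
  then have "t \<le> 140 * (n + m)" by simp
  then show "let n = card (verts G); m = card (edges G) in
      \<exists>t r a. exec ((n + m + 1) ^ 3) diam_5_program (input_state L) t (r, a) \<and>
        t \<le> 140 * (n + m) \<and> r 0 = (if diam G = 5 then 1 else 0)"
    using * unfolding Let_def W_def n_def m_def by blast
qed

theorem theorem14:
  "linear_time_decidable (connected_free_graph P3_2P1) (\<lambda>G. diam G = 5) \<and>
   d_max (connected_free_graph P3_2P1) = 5"
  using linear_time_diam_5 d_max_P3_2P1 by blast

end
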